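(* Let $N\ge 1$, $\Sigma_N=\{1,\dots,N\}$, $\omega_j\in\mathbb{R}_+$ for $j\in\Sigma_N$, and $\lambda\ge0$. Under planar Kuramoto initial conditions, the generalized Kuramoto model $$\dot{\vec S}_j=\omega_j\,\widehat e_3\times\vec S_j+\lambda\,\vec S_j\times(\vec J\times\vec S_j),\qquad j\in\Sigma_N,$$ admits the Hamiltonian $$H(\{\vec S_j,\vec P_j\})=\sum_{j=1}^N\Big\{-\frac{\omega_j}{2}\big[|\vec S_j|^2+|\vec P_j|^2\big]+\lambda(\vec J\times\vec S_j)\cdot(\vec P_j\times\vec S_j)\Big\},\qquad \vec J=\frac1N\sum_{k=1}^N\vec S_k,$$ that is, with planar initial conditions, Hamilton's equations for $H$ become the generalized Kuramoto equations for the spin variables $\{\vec S_j\}_{j\in\Sigma_N}$.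
   Context: $\widehat e_3=\langle0,0,1\rangle$; $\times$ and $\cdot$ are the cross and dot products in $\mathbb{R}^3$; a dot over a symbol denotes the time derivative. The phase space has independent canonical variables $\vec S_j,\vec P_j\in\mathbb{R}^3$, $j\in\Sigma_N$, where $\vec P_j$ is the momentum conjugate to $\vec S_j$; Hamilton's equations are $\dot{\vec S}_j=\partial H/\partial\vec P_j$, $\dot{\vec P}_j=-\partial H/\partial\vec S_j$. The mean field $\vec J$ is regarded as a function of the $\vec S_k$. Planar Kuramoto initial conditions mean: at $t=0$, $\vec S_j=\langle\cos\theta_j,\sin\theta_j,0\rangle$ for some $\theta_j\in\mathbb{R}$, and $\vec P_j=\vec S_j\times\widehat e_3$, for every $j\in\Sigma_N$. *)

theory Defs
  imports "HOL-Analysis.Analysis"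
begin

unbundle cross3_syntax

text \<open>
  A configuration of vectors indexed by \<open>{1..N}\<close> is a function \<open>nat \<Rightarrow> real^3\<close>; its values at
  indices outside \<open>{1..N}\<close> play no role. A trajectory maps a time to a configuration.
\<close>

definition e3 :: "real^3"
  where "e3 = vector [0, 0, 1]"

definition mean_field :: "nat \<Rightarrow> (nat \<Rightarrow> real^3) \<Rightarrow> real^3"
  where "mean_field N S = (1 / real N) *\<^sub>R (\<Sum>k=1..N. S k)"

definition kuramoto_solution ::
    "nat \<Rightarrow> (nat \<Rightarrow> real) \<Rightarrow> real \<Rightarrow> real set \<Rightarrow> (real \<Rightarrow> nat \<Rightarrow> real^3) \<Rightarrow> bool"
  where "kuramoto_solution N \<omega> lam T S \<longleftrightarrow>
    (\<forall>t\<in>T. \<forall>j\<in>{1..N}.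
      ((\<lambda>s. S s j) has_vector_derivative
        (\<omega> j *\<^sub>R (e3 \<times> S t j) + lam *\<^sub>R (S t j \<times> (mean_field N (S t) \<times> S t j))))
      (at t within T))"

definition kuramoto_hamiltonian ::
    "nat \<Rightarrow> (nat \<Rightarrow> real) \<Rightarrow> real \<Rightarrow> (nat \<Rightarrow> real^3) \<Rightarrow> (nat \<Rightarrow> real^3) \<Rightarrow> real"
  where "kuramoto_hamiltonian N \<omega> lam S P =
    (\<Sum>j=1..N. - (\<omega> j / 2) * ((norm (S j))\<^sup>2 + (norm (P j))\<^sup>2)
        + lam * ((mean_field N S \<times> S j) \<bullet> (P j \<times> S j)))"

text \<open>
  The gradients are taken in a single vector variable, all other canonical variables being held
  fixed. In particular the gradient in \<open>S j\<close> also sees the dependence of the mean field on \<open>S j\<close>.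
\<close>

definition hamilton_solution ::
    "nat \<Rightarrow> ((nat \<Rightarrow> real^3) \<Rightarrow> (nat \<Rightarrow> real^3) \<Rightarrow> real) \<Rightarrow> real set
      \<Rightarrow> (real \<Rightarrow> nat \<Rightarrow> real^3) \<Rightarrow> (real \<Rightarrow> nat \<Rightarrow> real^3) \<Rightarrow> bool"
  where "hamilton_solution N H T S P \<longleftrightarrow>
    (\<forall>t\<in>T. \<forall>j\<in>{1..N}.
      (\<exists>G. (GDERIV (\<lambda>p. H (S t) ((P t)(j := p))) (P t j) :> G) \<and>
           ((\<lambda>s. S s j) has_vector_derivative G) (at t within T)) \<and>
      (\<exists>G. (GDERIV (\<lambda>q. H ((S t)(j := q)) (P t)) (S t j) :> G) \<and>
           ((\<lambda>s. P s j) has_vector_derivative - G) (at t within T)))"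

definition planar_spins :: "nat \<Rightarrow> (nat \<Rightarrow> real^3) \<Rightarrow> bool"
  where "planar_spins N S \<longleftrightarrow>
    (\<exists>\<theta> :: nat \<Rightarrow> real. \<forall>j\<in>{1..N}. S j = vector [cos (\<theta> j), sin (\<theta> j), 0])"

definition planar_kuramoto_initial :: "nat \<Rightarrow> (nat \<Rightarrow> real^3) \<Rightarrow> (nat \<Rightarrow> real^3) \<Rightarrow> bool"
  where "planar_kuramoto_initial N S P \<longleftrightarrow>
    planar_spins N S \<and> (\<forall>j\<in>{1..N}. P j = S j \<times> e3)"

end

(*
  The planar set, on which every S_j is a unit vector orthogonal to e3 and P_j = S_j x e3, is
  invariant under both flows, and on it the two vector fields agree. For invariance, consider the
  defect (P_j - S_j x e3, S_j . e3, |S_j|^2 - 1). Along a solution its time derivative is linear in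
  the defects of all the spins, with coefficients bounded on compact time intervals, so a defect
  that vanishes initially vanishes for all time by Gronwall's inequality. The linearity rests on
  the identity (J . (s x e3)) s - (J . s) (s x e3) = J x (s x (s x e3)), with
  s x (s x e3) = (s . e3) s - |s|^2 e3, which cancels the terms coming from the dependence of the
  mean field on S_j.
*)

theory Submission
  imports Defs
begin

section \<open>Linear differential inequalities\<close>

text \<open>Multiplying \<open>E\<close> by the integrating factor \<open>exp (- M * s)\<close>
  gives a function with nonpositive derivative; the mean value theorem compares its values at 0 and
  \<open>b\<close>.\<close>

lemma gronwall_nonpos:
  fixes E E' :: "real \<Rightarrow> real"
  assumes "0 \<le> b"
    and der: "\<And>s. s \<in> {0..b} \<Longrightarrow> (E has_real_derivative E' s) (at s within {0..b})"
    and le: "\<And>s. s \<in> {0..b} \<Longrightarrow> E' s \<le> M * E s"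
    and "E 0 \<le> 0"
  shows "E b \<le> 0"
proof -
  let ?f = "\<lambda>s. exp (- M * s) * E s"
  have "\<exists>x\<in>{0..b}. ?f b - ?f 0 = (exp (- M * x) * (E' x - M * E x)) * (b - 0)"
  proof (rule mvt_very_simple[OF assms(1)])
    fix s assume "0 \<le> s" "s \<le> b"
    then have "(E has_real_derivative E' s) (at s within {0..b})"
      by (intro der) auto
    then have "(?f has_real_derivative exp (- M * s) * (E' s - M * E s)) (at s within {0..b})"
      by (auto intro!: derivative_eq_intros simp: algebra_simps)
    then show "(?f has_derivative (*) (exp (- M * s) * (E' s - M * E s))) (at s within {0..b})"
      by (simp add: has_field_derivative_def)
  qed
  then obtain x where x: "x \<in> {0..b}"
    and eq: "?f b - ?f 0 = (exp (- M * x) * (E' x - M * E x)) * (b - 0)" by blast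
  have "(exp (- M * x) * (E' x - M * E x)) * (b - 0) \<le> 0"
    using le[OF x] assms(1) by (intro mult_nonpos_nonneg mult_nonneg_nonpos) auto
  with eq assms(4) have "exp (- M * b) * E b \<le> 0" by simp
  then show ?thesis
    using mult_le_cancel_left_pos[of "exp (- M * b)" "E b" 0] by simp
qed

text \<open>Uniqueness of the zero solution. Cauchy-Schwarz turns the linear bound into an
  inequality \<open>E' \<le> M * E\<close> for the sum \<open>E\<close> of the squared norms, and
  Gronwall's inequality applies because \<open>E\<close> vanishes at time 0.\<close>

lemma linear_system_zero:
  fixes c c' :: "'i \<Rightarrow> real \<Rightarrow> 'a::real_inner"
  assumes "finite I" and T: "is_interval T" "0 \<in> T"
    and der: "\<And>i t. i \<in> I \<Longrightarrow> t \<in> T \<Longrightarrow> (c i has_vector_derivative c' i t) (at t within T)"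
    and bound: "\<And>i t. i \<in> I \<Longrightarrow> t \<in> T \<Longrightarrow> norm (c' i t) \<le> K t * (\<Sum>k\<in>I. norm (c k t))"
    and K: "continuous_on T K"
    and init: "\<And>i. i \<in> I \<Longrightarrow> c i 0 = 0"
    and "i \<in> I" "t \<in> T"
  shows "c i t = 0"
proof -
  \<comment> \<open>Running along \<open>s * t\<close> with \<open>s\<close> in the unit interval treats positive and negative \<open>t\<close> alike.\<close>
  have seg: "s * t \<in> T" if "s \<in> {0..1}" for s
    using that mem_is_interval_1_I[OF T(1,2) assms(9), of "s * t"]
      mem_is_interval_1_I[OF T(1) assms(9) T(2), of "s * t"]
    by (cases "t \<ge> 0") (auto simp: mult_le_cancel_right1 mult_le_cancel_right2 mult_le_0_iff)
  \<comment> \<open>\<open>K\<close> may be unbounded on \<open>T\<close>, so its bound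
    \<open>B\<close> is taken on the compact segment from 0 to \<open>t\<close>.\<close>
  have "compact ((\<lambda>s. s * t) ` {0..1})"
    by (intro compact_continuous_image continuous_intros) auto
  moreover have "(\<lambda>s. s * t) ` {0..1} \<subseteq> T" using seg by auto
  ultimately have "compact (K ` (\<lambda>s. s * t) ` {0..1})"
    using K by (blast intro: compact_continuous_image continuous_on_subset)
  then obtain B where B: "\<And>s. s \<in> {0..1} \<Longrightarrow> K (s * t) \<le> B"
    by (metis (no_types, lifting) bounded_imp_bdd_above bdd_above.E compact_imp_bounded image_eqI)
  let ?E = "\<lambda>s. \<Sum>k\<in>I. c k (s * t) \<bullet> c k (s * t)"
  let ?w = "\<lambda>s. \<Sum>k\<in>I. norm (c k (s * t))"
  \<comment> \<open>The factor 2 comes from differentiating a square, \<open>\<bar>t\<bar>\<close>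
    from the chain rule, \<open>\<bar>B\<bar>\<close> from the bound on \<open>K\<close>, and
    \<open>card I\<close> from comparing the square of a sum with the sum of the squares.\<close>
  define M where "M = 2 * \<bar>t\<bar> * \<bar>B\<bar> * card I"
  have "?E 1 \<le> 0"
  proof (rule gronwall_nonpos[where E = ?E and b = 1 and E' = "\<lambda>s. \<Sum>k\<in>I. 2 * (c k (s * t) \<bullet> (t *\<^sub>R c' k (s * t)))" and M = M])
    fix s :: real assume s: "s \<in> {0..1}"
    have "((\<lambda>s. c k (s * t)) has_vector_derivative t *\<^sub>R c' k (s * t)) (at s within {0..1})"
      if k: "k \<in> I" for k
    proof -
      have "(c k has_vector_derivative c' k (s * t)) (at (s * t) within (\<lambda>s. s * t) ` {0..1})"
        using der[OF k seg[OF s]] seg by (auto intro: has_vector_derivative_within_subset)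
      moreover have "((\<lambda>s. s * t) has_vector_derivative t) (at s within {0..1})"
        by (auto intro!: derivative_eq_intros simp: has_vector_derivative_def)
      ultimately show ?thesis
        using vector_diff_chain_within[of "\<lambda>s. s * t" t s "{0..1}" "c k"] by (simp add: o_def)
    qed
    then have "((\<lambda>s. c k (s * t)) has_derivative (\<lambda>x. x *\<^sub>R t *\<^sub>R c' k (s * t))) (at s within {0..1})"
      if "k \<in> I" for k
      using that by (simp add: has_vector_derivative_def)
    then show "(?E has_real_derivative (\<Sum>k\<in>I. 2 * (c k (s * t) \<bullet> (t *\<^sub>R c' k (s * t)))))
        (at s within {0..1})"
      unfolding has_field_derivative_def
      by (auto intro!: derivative_eq_intros simp: sum_distrib_left inner_commute algebra_simps fun_eq_iff
          intro!: sum.cong)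
    have w: "0 \<le> ?w s" by (simp add: sum_nonneg)
    have "(\<Sum>k\<in>I. 2 * (c k (s * t) \<bullet> (t *\<^sub>R c' k (s * t)))) \<le> (\<Sum>k\<in>I. 2 * (norm (c k (s * t)) * (\<bar>t\<bar> * (\<bar>B\<bar> * ?w s))))"
    proof (rule sum_mono)
      fix k assume k: "k \<in> I"
      have "c k (s * t) \<bullet> (t *\<^sub>R c' k (s * t)) \<le> norm (c k (s * t)) * (\<bar>t\<bar> * norm (c' k (s * t)))"
        using norm_cauchy_schwarz[of "c k (s * t)" "t *\<^sub>R c' k (s * t)"] by simp
      also have "\<dots> \<le> norm (c k (s * t)) * (\<bar>t\<bar> * (K (s * t) * ?w s))"
        using bound[OF k seg[OF s]] by (intro mult_left_mono) auto
      also have "\<dots> \<le> norm (c k (s * t)) * (\<bar>t\<bar> * (\<bar>B\<bar> * ?w s))"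
        using B[OF s] w by (intro mult_left_mono mult_right_mono) auto
      finally show "2 * (c k (s * t) \<bullet> (t *\<^sub>R c' k (s * t))) \<le> 2 * (norm (c k (s * t)) * (\<bar>t\<bar> * (\<bar>B\<bar> * ?w s)))"
        by simp
    qed
    also have "\<dots> = 2 * \<bar>t\<bar> * \<bar>B\<bar> * (?w s)\<^sup>2"
      by (simp add: power2_eq_square sum_distrib_left sum_distrib_right mult_ac)
    also have "\<dots> \<le> 2 * \<bar>t\<bar> * \<bar>B\<bar> * (card I * ?E s)"
      using sum_squared_le_sum_of_squares[of "\<lambda>k. norm (c k (s * t))" I]
      by (intro mult_left_mono) (auto simp: power2_norm_eq_inner mult_ac)
    finally show "(\<Sum>k\<in>I. 2 * (c k (s * t) \<bullet> (t *\<^sub>R c' k (s * t)))) \<le> M * ?E s"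
      by (simp add: M_def mult_ac)
  qed (use init in auto)
  then have "?E 1 = 0" by (intro antisym sum_nonneg) auto
  then show ?thesis
    using assms(1,8) by (simp add: sum_nonneg_eq_0_iff)
qed

section \<open>Gradients of the Hamiltonian\<close>

lemma bounded_bilinear_cross3: "bounded_bilinear (\<lambda>x y. x \<times> y)"
  using bilinear_cross bilinear_conv_bounded_bilinear by blast

lemmas has_derivative_cross3 [derivative_intros] =
  bounded_bilinear.FDERIV[OF bounded_bilinear_cross3]

lemma norm_cross3_le: "norm (x \<times> y) \<le> norm x * norm y"
proof (rule power2_le_imp_le)
  show "(norm (x \<times> y))\<^sup>2 \<le> (norm x * norm y)\<^sup>2"
    using norm_cross_dot[of x y] zero_le_power2[of "x \<bullet> y"] by linarith
qed simp

lemma norm_e3 [simp]: "norm e3 = 1"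
  by (simp add: e3_def norm_eq_sqrt_inner inner_vec_def sum_3)

text \<open>The gradient of the Hamiltonian in \<open>P j\<close>, obtained from (J x s) . (p x s) =
  p . (s x (J x s)).\<close>

definition spin_velocity ::
    "nat \<Rightarrow> (nat \<Rightarrow> real) \<Rightarrow> real \<Rightarrow> (nat \<Rightarrow> real^3) \<Rightarrow> (nat \<Rightarrow> real^3) \<Rightarrow> nat \<Rightarrow> real^3"
  where "spin_velocity N \<omega> lam S P j =
    - \<omega> j *\<^sub>R P j + lam *\<^sub>R (S j \<times> (mean_field N S \<times> S j))"

text \<open>The gradient of the Hamiltonian in \<open>S j\<close>, after expanding (J x s) . (p x s)
  = (J . p) |s|^2 - (J . s) (s . p). The last mean field is the contribution of the dependence of J
  on \<open>S j\<close>, which enters through every summand.\<close>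

definition spin_gradient ::
    "nat \<Rightarrow> (nat \<Rightarrow> real) \<Rightarrow> real \<Rightarrow> (nat \<Rightarrow> real^3) \<Rightarrow> (nat \<Rightarrow> real^3) \<Rightarrow> nat \<Rightarrow> real^3"
  where "spin_gradient N \<omega> lam S P j =
    - \<omega> j *\<^sub>R S j + lam *\<^sub>R
      ((2 * (mean_field N S \<bullet> P j)) *\<^sub>R S j - (S j \<bullet> P j) *\<^sub>R mean_field N S
        - (mean_field N S \<bullet> S j) *\<^sub>R P j
        + mean_field N (\<lambda>k. (S k \<bullet> S k) *\<^sub>R P k - (S k \<bullet> P k) *\<^sub>R S k))"

lemma has_derivative_fun_upd:
  "((\<lambda>q. (f(j := q)) i) has_derivative (\<lambda>h. if i = j then h else 0)) (at x)"
  by (cases "i = j") (auto intro!: derivative_eq_intros)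

text \<open>The mean field does not involve the momenta, so only the summand with index
  \<open>j\<close> varies.\<close>

lemma GDERIV_momentum:
  assumes j: "j \<in> {1..N}"
  shows "GDERIV (\<lambda>p. kuramoto_hamiltonian N \<omega> lam S (P(j := p))) (P j) :> spin_velocity N \<omega> lam S P j"
proof -
  let ?J = "mean_field N S"
  have "((\<lambda>p. kuramoto_hamiltonian N \<omega> lam S (P(j := p))) has_derivative
      (\<lambda>h. \<Sum>i=1..N. if i = j then h \<bullet> spin_velocity N \<omega> lam S P i else 0)) (at (P j))"
    unfolding kuramoto_hamiltonian_def power2_norm_eq_inner
  proof (rule has_derivative_sum)
    fix i assume "i \<in> {1..N}"
    show "((\<lambda>p. - (\<omega> i / 2) * (S i \<bullet> S i + (P(j := p)) i \<bullet> (P(j := p)) i)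
          + lam * ((?J \<times> S i) \<bullet> ((P(j := p)) i \<times> S i))) has_derivative
        (\<lambda>h. if i = j then h \<bullet> spin_velocity N \<omega> lam S P i else 0)) (at (P j))"
      apply (rule derivative_eq_intros has_derivative_fun_upd refl)+
      apply (auto simp: fun_eq_iff spin_velocity_def inner_add_right inner_commute)
      apply (simp add: dot_cross Lagrange inner_diff_right inner_commute algebra_simps)
      done
  qed
  then show ?thesis
    using j by (simp add: gderiv_def inner_commute)
qed

lemma GDERIV_spin:
  assumes j: "j \<in> {1..N}"
  shows "GDERIV (\<lambda>q. kuramoto_hamiltonian N \<omega> lam (S(j := q)) P) (S j) :> spin_gradient N \<omega> lam S P j"
proof -
  let ?J = "mean_field N S"
  have J: "((\<lambda>q. mean_field N (S(j := q))) has_derivative (\<lambda>h. (1 / N) *\<^sub>R h)) (at (S j))"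
    unfolding mean_field_def
    apply (rule derivative_eq_intros has_derivative_fun_upd refl)+
    using j by simp
  \<comment> \<open>\<open>?G\<close> is the derivative of a summand with the mean field frozen; it
    counts only for \<open>i = j\<close>. \<open>?F\<close> is the derivative through the mean
    field, whose own derivative is \<open>1 / N\<close> times the identity, and it counts for every
    \<open>i\<close>.\<close>
  let ?G = "\<lambda>i. - \<omega> i *\<^sub>R S i + lam *\<^sub>R
      ((2 * (?J \<bullet> P i)) *\<^sub>R S i - (S i \<bullet> P i) *\<^sub>R ?J - (?J \<bullet> S i) *\<^sub>R P i)"
  let ?F = "\<lambda>i. (lam / N) *\<^sub>R ((S i \<bullet> S i) *\<^sub>R P i - (S i \<bullet> P i) *\<^sub>R S i)"
  have "((\<lambda>q. kuramoto_hamiltonian N \<omega> lam (S(j := q)) P) has_derivative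
      (\<lambda>h. \<Sum>i=1..N. (if i = j then h \<bullet> ?G i else 0) + h \<bullet> ?F i)) (at (S j))"
    unfolding kuramoto_hamiltonian_def power2_norm_eq_inner
  proof (rule has_derivative_sum)
    fix i assume "i \<in> {1..N}"
    show "((\<lambda>q. - (\<omega> i / 2) * ((S(j := q)) i \<bullet> (S(j := q)) i + P i \<bullet> P i)
          + lam * ((mean_field N (S(j := q)) \<times> (S(j := q)) i) \<bullet> (P i \<times> (S(j := q)) i))) has_derivative
        (\<lambda>h. (if i = j then h \<bullet> ?G i else 0) + h \<bullet> ?F i)) (at (S j))"
      apply (rule derivative_eq_intros has_derivative_fun_upd J refl)+
      apply (auto simp: fun_eq_iff dot_cross cross_mult_left)
       apply (simp_all add: inner_add_left inner_add_right inner_diff_right dot_cross algebra_simps inner_commute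
          add_divide_distrib diff_divide_distrib)
      done
  qed
  moreover have "(\<Sum>i=1..N. (if i = j then h \<bullet> ?G i else 0) + h \<bullet> ?F i) = h \<bullet> spin_gradient N \<omega> lam S P j" for h
  proof -
    have "(\<Sum>i=1..N. (if i = j then h \<bullet> ?G i else 0) + h \<bullet> ?F i) = h \<bullet> (?G j + (\<Sum>i=1..N. ?F i))"
      using j by (simp add: sum.distrib inner_add_right inner_sum_right)
    also have "?G j + (\<Sum>i=1..N. ?F i) = spin_gradient N \<omega> lam S P j"
      by (simp only: spin_gradient_def mean_field_def[of N "\<lambda>k. (S k \<bullet> S k) *\<^sub>R P k - (S k \<bullet> P k) *\<^sub>R S k"]
          scaleR_add_right scaleR_scaleR scaleR_sum_right add.assoc) simp
    finally show ?thesis .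
  qed
  ultimately show ?thesis
    by (simp add: gderiv_def inner_commute)
qed

lemma GDERIV_unique:
  assumes "GDERIV f x :> a" "GDERIV f x :> b"
  shows "a = b"
proof -
  have "(\<lambda>h. h \<bullet> a) = (\<lambda>h. h \<bullet> b)"
    using assms unfolding gderiv_def by (rule has_derivative_unique)
  then show ?thesis by (metis vector_eq_rdot inner_commute)
qed

text \<open>Uniqueness of gradients replaces the existentially quantified gradients by the two
  explicit formulas.\<close>

lemma hamilton_solution_iff:
  "hamilton_solution N (kuramoto_hamiltonian N \<omega> lam) T S P \<longleftrightarrow>
    (\<forall>t\<in>T. \<forall>j\<in>{1..N}.
      ((\<lambda>s. S s j) has_vector_derivative spin_velocity N \<omega> lam (S t) (P t) j) (at t within T) \<and>
      ((\<lambda>s. P s j) has_vector_derivative - spin_gradient N \<omega> lam (S t) (P t) j) (at t within T))"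
proof -
  have ex: "(\<exists>G. (GDERIV f x :> G) \<and> Q G) \<longleftrightarrow> Q g" if "GDERIV f x :> g"
    for f x Q and g :: "real^3"
    using that GDERIV_unique[OF that] by blast
  show ?thesis
    unfolding hamilton_solution_def
    by (intro ball_cong refl arg_cong2[where f = "(\<and>)"] ex GDERIV_momentum GDERIV_spin)
qed

section \<open>The planar manifold\<close>

text \<open>The three deviations are packed into one vector of a product inner product space, so
  that \<open>linear_system_zero\<close> applies with one component per spin.\<close>

definition planar_defect :: "real^3 \<Rightarrow> real^3 \<Rightarrow> (real^3) \<times> real \<times> real"
  where "planar_defect s p = (p - s \<times> e3, s \<bullet> e3, s \<bullet> s - 1)"

text \<open>The left side is the rate of change of P - S x e3 for one spin under Hamilton's
  equations. The mean field term is split into \<open>J \<times> e3\<close>, its value on the planar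
  set, and a remainder \<open>X\<close>. On the right every term other than \<open>X\<close> has a
  factor \<open>d\<close>, \<open>z\<close> or \<open>n\<close>. In coordinates this is a polynomial
  identity.\<close>

lemma defect_derivative_identity:
  fixes J s p X :: "real^3" and w l :: real
  defines "d \<equiv> p - s \<times> e3" and "z \<equiv> s \<bullet> e3" and "n \<equiv> s \<bullet> s - 1"
  shows "- (- w *\<^sub>R s + l *\<^sub>R ((2 * (J \<bullet> p)) *\<^sub>R s - (s \<bullet> p) *\<^sub>R J - (J \<bullet> s) *\<^sub>R p + (J \<times> e3 + X)))
      - (- w *\<^sub>R p + l *\<^sub>R (s \<times> (J \<times> s))) \<times> e3 =
    w *\<^sub>R (z *\<^sub>R e3 + d \<times> e3) - l *\<^sub>R ((2 * (J \<bullet> d)) *\<^sub>R s - (s \<bullet> d) *\<^sub>R J - (J \<bullet> s) *\<^sub>R d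
      + (2 * z) *\<^sub>R (J \<times> s) - n *\<^sub>R (J \<times> e3) + X)"
  unfolding d_def z_def n_def e3_def
  by (simp add: vec_eq_iff forall_3 cross_components inner_vec_def sum_3)
    (intro conjI; algebra)


section \<open>Size and linearity of the mean field\<close>

lemma norm_mean_field_le:
  assumes "N \<ge> 1" and "\<And>k. k \<in> {1..N} \<Longrightarrow> norm (f k) \<le> b"
  shows "norm (mean_field N f) \<le> b"
proof -
  have "norm (\<Sum>k=1..N. f k) \<le> (\<Sum>k=1..N. b)"
    using assms(2) by (intro sum_norm_le) auto
  then show ?thesis
    using assms(1) by (simp add: mean_field_def field_simps)
qed

lemma mean_field_inner: "mean_field N S \<bullet> v = (1 / real N) * (\<Sum>k=1..N. S k \<bullet> v)"
  by (simp add: mean_field_def inner_sum_left)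

lemma mean_field_add: "mean_field N (\<lambda>k. f k + g k) = mean_field N f + mean_field N g"
  by (simp add: mean_field_def sum.distrib scaleR_add_right)

lemma mean_field_cross: "mean_field N (\<lambda>k. f k \<times> v) = mean_field N f \<times> v"
proof -
  have "(\<Sum>k=1..N. f k \<times> v) = (\<Sum>k=1..N. f k) \<times> v"
    by (rule bounded_linear.linear[OF bounded_bilinear.bounded_linear_left[OF bounded_bilinear_cross3],
          THEN linear_sum, symmetric])
  then show ?thesis by (simp add: mean_field_def cross_mult_left)
qed

section \<open>Rates of change of the defect, bounded linearly in the total defect
  \<open>w\<close>\<close>

context
  fixes N :: nat and \<omega> :: "nat \<Rightarrow> real" and lam :: real and S P :: "nat \<Rightarrow> real^3"
    and B w :: real
  assumes N: "N \<ge> 1"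
  defines "B \<equiv> \<Sum>k=1..N. norm (S k)"
    and "w \<equiv> \<Sum>k=1..N. norm (planar_defect (S k) (P k))"
begin

lemma B_nonneg: "0 \<le> B" and w_nonneg: "0 \<le> w"
  by (simp_all add: B_def w_def sum_nonneg)

lemma norm_spin_le: "k \<in> {1..N} \<Longrightarrow> norm (S k) \<le> B"
  unfolding B_def by (rule member_le_sum) auto

lemma norm_mean_field_spin_le: "norm (mean_field N S) \<le> B"
  using N norm_spin_le by (rule norm_mean_field_le)

lemma norm_planar_defect_le: "k \<in> {1..N} \<Longrightarrow> norm (planar_defect (S k) (P k)) \<le> w"
  unfolding w_def by (rule member_le_sum[of k]) auto

lemma defect_components_le:
  assumes "k \<in> {1..N}"
  shows "norm (P k - S k \<times> e3) \<le> w" "\<bar>S k \<bullet> e3\<bar> \<le> w" "\<bar>S k \<bullet> S k - 1\<bar> \<le> w"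
proof -
  note le = norm_planar_defect_le[OF assms]
  show "norm (P k - S k \<times> e3) \<le> w"
    using norm_fst_le[of "P k - S k \<times> e3" "(S k \<bullet> e3, S k \<bullet> S k - 1)"] le
    by (simp add: planar_defect_def)
  have *: "norm (S k \<bullet> e3, S k \<bullet> S k - 1) \<le> w"
    using norm_snd_le[of "(S k \<bullet> e3, S k \<bullet> S k - 1)" "P k - S k \<times> e3"] le
    by (simp add: planar_defect_def)
  show "\<bar>S k \<bullet> e3\<bar> \<le> w" "\<bar>S k \<bullet> S k - 1\<bar> \<le> w"
    using norm_fst_le[of "S k \<bullet> e3" "S k \<bullet> S k - 1"] norm_snd_le[of "S k \<bullet> S k - 1" "S k \<bullet> e3"] *
    by simp_all
qed

text \<open>By \<open>defect_derivative_identity\<close> each term of the rate contains one defect,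
  of spin \<open>j\<close> or, inside the remainder, of some spin \<open>k\<close>. Defects are at
  most \<open>w\<close>, while the spins and their mean are at most \<open>B\<close>; adding up the
  terms gives the constants.\<close>

lemma norm_momentum_defect_rate_le:
  assumes j: "j \<in> {1..N}"
  shows "norm (- spin_gradient N \<omega> lam S P j - spin_velocity N \<omega> lam S P j \<times> e3)
    \<le> (2 * \<bar>\<omega> j\<bar> + \<bar>lam\<bar> * (8 * B\<^sup>2 + 2 * B)) * w"
proof -
  define J where "J = mean_field N S"
  define d z n where "d = (\<lambda>k. P k - S k \<times> e3)" and "z = (\<lambda>k. S k \<bullet> e3)"
    and "n = (\<lambda>k. S k \<bullet> S k - 1)"
  \<comment> \<open>What remains of the \<open>k\<close>-th summand in the last mean field of
    \<open>spin_gradient\<close> once its planar value \<open>S k \<times> e3\<close> is split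
    off.\<close>
  let ?x = "\<lambda>k. (S k \<bullet> S k) *\<^sub>R d k + n k *\<^sub>R (S k \<times> e3) - (S k \<bullet> d k) *\<^sub>R S k"
  define X where "X = mean_field N ?x"
  have J: "norm J \<le> B" unfolding J_def by (rule norm_mean_field_spin_le)
  have c: "norm (d k) \<le> w" "\<bar>z k\<bar> \<le> w" "\<bar>n k\<bar> \<le> w" if "k \<in> {1..N}" for k
    using defect_components_le[OF that] by (simp_all add: d_def z_def n_def)
  have inn: "\<bar>a \<bullet> b\<bar> \<le> \<alpha> * \<beta>" if "norm a \<le> \<alpha>" "norm b \<le> \<beta>" for a b :: "real^3" and \<alpha> \<beta>
    by (rule order_trans[OF Cauchy_Schwarz_ineq2]) (use that in \<open>auto intro!: mult_mono order_trans[OF norm_ge_zero]\<close>)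
  have crs: "norm (a \<times> b) \<le> \<alpha> * \<beta>" if "norm a \<le> \<alpha>" "norm b \<le> \<beta>" for a b :: "real^3" and \<alpha> \<beta>
    by (rule order_trans[OF norm_cross3_le]) (use that in \<open>auto intro!: mult_mono order_trans[OF norm_ge_zero]\<close>)
  have scl: "norm (r *\<^sub>R a) \<le> \<rho> * \<alpha>" if "\<bar>r\<bar> \<le> \<rho>" "norm a \<le> \<alpha>" for r \<rho> \<alpha> and a :: "real^3"
    using that by (simp add: mult_mono')
  have add: "norm (a + b) \<le> \<alpha> + \<beta>" if "norm a \<le> \<alpha>" "norm b \<le> \<beta>" for a b :: "real^3" and \<alpha> \<beta>
    using that norm_triangle_ineq[of a b] by linarith
  have sub: "norm (a - b) \<le> \<alpha> + \<beta>" if "norm a \<le> \<alpha>" "norm b \<le> \<beta>" for a b :: "real^3" and \<alpha> \<beta>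
    using that norm_triangle_ineq4[of a b] by linarith
  have dbl: "\<bar>2 * r\<bar> \<le> 2 * \<rho>" if "\<bar>r\<bar> \<le> \<rho>" for r \<rho> :: real
    using that by simp
  \<comment> \<open>These rules follow the syntax of an expression, so each bound below is its
    expression with every vector and scalar replaced by an upper bound.\<close>
  note bounds = add sub scl crs inn dbl norm_spin_le J c j eq_refl[OF norm_e3]
  have X: "norm X \<le> B * B * w + w * (B * 1) + B * w * B"
    unfolding X_def using N by (rule norm_mean_field_le) (intro bounds; assumption)
  have "mean_field N (\<lambda>k. (S k \<bullet> S k) *\<^sub>R P k - (S k \<bullet> P k) *\<^sub>R S k)
      = mean_field N (\<lambda>k. S k \<times> e3 + ?x k)"
  proof -
    have "(s \<bullet> s) *\<^sub>R p - (s \<bullet> p) *\<^sub>R s = s \<times> e3 + ((s \<bullet> s) *\<^sub>R (p - s \<times> e3)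
        + (s \<bullet> s - 1) *\<^sub>R (s \<times> e3) - (s \<bullet> (p - s \<times> e3)) *\<^sub>R s)" for s p
      by (simp add: inner_diff_right dot_cross_self algebra_simps)
    then show ?thesis by (simp add: d_def n_def)
  qed
  also have "\<dots> = J \<times> e3 + X"
    by (simp only: mean_field_add[of N "\<lambda>k. S k \<times> e3" ?x] mean_field_cross X_def J_def)
  finally have "- spin_gradient N \<omega> lam S P j - spin_velocity N \<omega> lam S P j \<times> e3 =
    \<omega> j *\<^sub>R (z j *\<^sub>R e3 + d j \<times> e3) - lam *\<^sub>R ((2 * (J \<bullet> d j)) *\<^sub>R S j - (S j \<bullet> d j) *\<^sub>R J
      - (J \<bullet> S j) *\<^sub>R d j + (2 * z j) *\<^sub>R (J \<times> S j) - n j *\<^sub>R (J \<times> e3) + X)"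
    unfolding spin_gradient_def spin_velocity_def J_def[symmetric] d_def z_def n_def
    by (simp only: defect_derivative_identity)
  also have "norm \<dots> \<le> \<bar>\<omega> j\<bar> * (w * 1 + w * 1) + \<bar>lam\<bar> * (2 * (B * w) * B + B * w * B + B * B * w
      + 2 * w * (B * B) + w * (B * 1) + (B * B * w + w * (B * 1) + B * w * B))"
    by (intro bounds X order_refl)
  also have "\<dots> = (2 * \<bar>\<omega> j\<bar> + \<bar>lam\<bar> * (8 * B\<^sup>2 + 2 * B)) * w"
    by (simp add: algebra_simps power2_eq_square)
  finally show ?thesis .
qed

text \<open>Since S x e3 is orthogonal to e3, \<open>P j \<bullet> e3\<close> only sees the momentum
  defect. Expanding the triple product leaves the height of spin \<open>j\<close> and the mean of
  all heights.\<close>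

lemma height_rate_le:
  assumes j: "j \<in> {1..N}"
  shows "\<bar>spin_velocity N \<omega> lam S P j \<bullet> e3\<bar> \<le> (\<bar>\<omega> j\<bar> + \<bar>lam\<bar> * (2 * B\<^sup>2)) * w"
proof -
  define J where "J = mean_field N S"
  note nn = B_nonneg w_nonneg
  have J: "norm J \<le> B" unfolding J_def by (rule norm_mean_field_spin_le)
  have Je: "\<bar>J \<bullet> e3\<bar> \<le> w"
  proof -
    have "(\<Sum>k=1..N. \<bar>S k \<bullet> e3\<bar>) \<le> (\<Sum>k=1..N. w)"
      using defect_components_le by (intro sum_mono) auto
    then have "\<bar>\<Sum>k=1..N. S k \<bullet> e3\<bar> \<le> N * w"
      by (intro order_trans[OF sum_abs]) simp
    then show ?thesis
      using N by (simp add: J_def mean_field_inner abs_mult field_simps)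
  qed
  have SS: "\<bar>S j \<bullet> S j\<bar> \<le> B * B" and JS: "\<bar>J \<bullet> S j\<bar> \<le> B * B"
    by (rule order_trans[OF Cauchy_Schwarz_ineq2], intro mult_mono norm_spin_le J j nn norm_ge_zero)+
  have Pe: "\<bar>P j \<bullet> e3\<bar> \<le> w"
  proof -
    have "P j \<bullet> e3 = (P j - S j \<times> e3) \<bullet> e3"
      by (simp add: inner_diff_left dot_cross_self)
    then show ?thesis
      using Cauchy_Schwarz_ineq2[of "P j - S j \<times> e3" e3] defect_components_le(1)[OF j] by simp
  qed
  have "spin_velocity N \<omega> lam S P j \<bullet> e3 =
      - \<omega> j * (P j \<bullet> e3) + lam * ((S j \<bullet> S j) * (J \<bullet> e3) - (J \<bullet> S j) * (S j \<bullet> e3))"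
    by (simp add: spin_velocity_def J_def[symmetric] Lagrange inner_add_right inner_diff_right inner_commute[of _ e3]
        inner_commute[of J])
  also have "\<bar>\<dots>\<bar> \<le> \<bar>\<omega> j\<bar> * \<bar>P j \<bullet> e3\<bar> + \<bar>lam\<bar> * (\<bar>S j \<bullet> S j\<bar> * \<bar>J \<bullet> e3\<bar> + \<bar>J \<bullet> S j\<bar> * \<bar>S j \<bullet> e3\<bar>)"
    by (rule order_trans[OF abs_triangle_ineq])
      (auto simp: abs_mult intro!: mult_left_mono order_trans[OF abs_triangle_ineq4])
  also have "\<dots> \<le> \<bar>\<omega> j\<bar> * w + \<bar>lam\<bar> * (B * B * w + B * B * w)"
    using Pe Je SS JS defect_components_le(2)[OF j] nn
    by (intro add_mono mult_left_mono mult_mono) auto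
  finally show ?thesis by (simp add: algebra_simps power2_eq_square)
qed

text \<open>The coupling term and S x e3 are both orthogonal to S, so only the momentum defect
  contributes.\<close>

lemma radius_rate_le:
  assumes j: "j \<in> {1..N}"
  shows "\<bar>2 * (S j \<bullet> spin_velocity N \<omega> lam S P j)\<bar> \<le> 2 * \<bar>\<omega> j\<bar> * B * w"
proof -
  have "S j \<bullet> spin_velocity N \<omega> lam S P j = - \<omega> j * (S j \<bullet> (P j - S j \<times> e3))"
    by (simp add: spin_velocity_def inner_add_right inner_diff_right dot_cross_self)
  moreover have "\<bar>S j \<bullet> (P j - S j \<times> e3)\<bar> \<le> B * w"
    by (rule order_trans[OF Cauchy_Schwarz_ineq2])
      (intro mult_mono norm_spin_le defect_components_le j B_nonneg norm_ge_zero)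
  ultimately show ?thesis
    by (simp add: abs_mult mult.assoc mult_left_mono)
qed

text \<open>Collects the three bounds: 2 + 1 + 2B for the frequencies and 8 + 2 for the coefficient
  of \<open>B\<^sup>2\<close>. Summing over all frequencies makes the coefficient independent of
  \<open>j\<close>. The free vector \<open>g\<close> allows for momenta that are prescribed instead
  of evolving by Hamilton's equations.\<close>

lemma norm_defect_rate_le:
  assumes j: "j \<in> {1..N}"
    and g: "norm g \<le> norm (- spin_gradient N \<omega> lam S P j - spin_velocity N \<omega> lam S P j \<times> e3)"
  shows "norm (g, spin_velocity N \<omega> lam S P j \<bullet> e3, 2 * (S j \<bullet> spin_velocity N \<omega> lam S P j))
    \<le> ((\<Sum>k=1..N. \<bar>\<omega> k\<bar>) * (3 + 2 * B) + \<bar>lam\<bar> * (10 * B\<^sup>2 + 2 * B)) * w"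
proof -
  let ?v = "spin_velocity N \<omega> lam S P j"
  have "norm (g, ?v \<bullet> e3, 2 * (S j \<bullet> ?v)) \<le> norm g + (\<bar>?v \<bullet> e3\<bar> + \<bar>2 * (S j \<bullet> ?v)\<bar>)"
    using norm_Pair_le[of g "(?v \<bullet> e3, 2 * (S j \<bullet> ?v))"] norm_Pair_le[of "?v \<bullet> e3" "2 * (S j \<bullet> ?v)"]
    by simp
  also have "\<dots> \<le> (\<bar>\<omega> j\<bar> * (3 + 2 * B) + \<bar>lam\<bar> * (10 * B\<^sup>2 + 2 * B)) * w"
    using g norm_momentum_defect_rate_le[OF j] height_rate_le[OF j] radius_rate_le[OF j]
    by (simp add: algebra_simps)
  also have "\<dots> \<le> ((\<Sum>k=1..N. \<bar>\<omega> k\<bar>) * (3 + 2 * B) + \<bar>lam\<bar> * (10 * B\<^sup>2 + 2 * B)) * w"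
    using j B_nonneg w_nonneg
    by (intro mult_right_mono add_right_mono member_le_sum) auto
  finally show ?thesis .
qed

text \<open>On the planar set the bound on the rate is zero. This is how S x e3 is seen to obey the
  momentum equation.\<close>

lemma momentum_defect_rate_zero:
  assumes "\<And>k. k \<in> {1..N} \<Longrightarrow> planar_defect (S k) (P k) = 0" and j: "j \<in> {1..N}"
  shows "- spin_gradient N \<omega> lam S P j = spin_velocity N \<omega> lam S P j \<times> e3"
proof -
  have "w = 0" using assms(1) by (simp add: w_def)
  then show ?thesis using norm_momentum_defect_rate_le[OF j] by simp
qed

end

section \<open>Invariance of the planar set\<close>

lemma planar_kuramoto_initial_defect:
  assumes "planar_kuramoto_initial N S P" "j \<in> {1..N}"
  shows "planar_defect (S j) (P j) = 0"
proof -
  obtain \<theta> where "S j = vector [cos \<theta>, sin \<theta>, 0]" "P j = S j \<times> e3"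
    using assms unfolding planar_kuramoto_initial_def planar_spins_def by blast
  then show ?thesis
    by (simp add: planar_defect_def e3_def inner_vec_def sum_3 zero_prod_def flip: power2_eq_square)
qed

text \<open>
  The momenta either obey Hamilton's equations or are defined as \<open>S \<times> e3\<close>. The hypothesis on \<open>G\<close>
  covers both cases: it is an equality in the first, and \<open>G = 0\<close> in the second.
\<close>

lemma planar_defect_invariant:
  fixes S P G :: "real \<Rightarrow> nat \<Rightarrow> real^3"
  assumes N: "N \<ge> 1" and T: "is_interval T" "0 \<in> T"
    and init: "planar_kuramoto_initial N (S 0) (P 0)"
    and dS: "\<And>t j. t \<in> T \<Longrightarrow> j \<in> {1..N} \<Longrightarrow>
      ((\<lambda>s. S s j) has_vector_derivative spin_velocity N \<omega> lam (S t) (P t) j) (at t within T)"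
    and dD: "\<And>t j. t \<in> T \<Longrightarrow> j \<in> {1..N} \<Longrightarrow>
      ((\<lambda>s. P s j - S s j \<times> e3) has_vector_derivative G t j) (at t within T)"
    and G: "\<And>t j. t \<in> T \<Longrightarrow> j \<in> {1..N} \<Longrightarrow> norm (G t j) \<le>
      norm (- spin_gradient N \<omega> lam (S t) (P t) j - spin_velocity N \<omega> lam (S t) (P t) j \<times> e3)"
    and t: "t \<in> T" and j: "j \<in> {1..N}"
  shows "planar_defect (S t j) (P t j) = 0"
proof -
  let ?B = "\<lambda>t. \<Sum>k=1..N. norm (S t k)"
  let ?K = "\<lambda>t. (\<Sum>k=1..N. \<bar>\<omega> k\<bar>) * (3 + 2 * ?B t) + \<bar>lam\<bar> * (10 * (?B t)\<^sup>2 + 2 * ?B t)"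
  let ?v = "\<lambda>j t. spin_velocity N \<omega> lam (S t) (P t) j"
  show ?thesis
  proof (rule linear_system_zero[where I = "{1..N}" and T = T and K = ?K
        and c = "\<lambda>j t. planar_defect (S t j) (P t j)"
        and c' = "\<lambda>j t. (G t j, ?v j t \<bullet> e3, 2 * (S t j \<bullet> ?v j t))"])
    fix j t assume j: "j \<in> {1..N}" and t: "t \<in> T"
    note dS = dS[OF t j]
    have "((\<lambda>t. S t j \<bullet> e3) has_vector_derivative ?v j t \<bullet> e3) (at t within T)"
      using bounded_linear.has_vector_derivative[OF bounded_linear_inner_left dS] .
    moreover have "((\<lambda>t. S t j \<bullet> S t j - 1) has_vector_derivative 2 * (S t j \<bullet> ?v j t)) (at t within T)"
      using has_vector_derivative_diff[OF
          bounded_bilinear.has_vector_derivative[OF bounded_bilinear_inner dS dS]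
          has_vector_derivative_const[of 1]]
      by (simp add: inner_commute)
    ultimately show "((\<lambda>t. planar_defect (S t j) (P t j)) has_vector_derivative
        (G t j, ?v j t \<bullet> e3, 2 * (S t j \<bullet> ?v j t))) (at t within T)"
      unfolding planar_defect_def by (intro has_vector_derivative_Pair dD[OF t j])
    show "norm (G t j, ?v j t \<bullet> e3, 2 * (S t j \<bullet> ?v j t))
        \<le> ?K t * (\<Sum>k=1..N. norm (planar_defect (S t k) (P t k)))"
      by (rule norm_defect_rate_le[OF N j G[OF t j]])
  next
    \<comment> \<open>The coefficient \<open>?K\<close> depends on time through the spins alone,
      which are continuous on \<open>T\<close> because they are differentiable there.\<close>
    have "continuous_on T (\<lambda>t. S t k)" if "k \<in> {1..N}" for k
      using dS[OF _ that] unfolding continuous_on_eq_continuous_within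
      by (blast intro: has_vector_derivative_continuous)
    then show "continuous_on T ?K" by (intro continuous_intros) auto
  qed (use planar_kuramoto_initial_defect[OF init] T t j in auto)
qed

theorem theorem7:
  fixes N :: nat and \<omega> :: "nat \<Rightarrow> real" and lam :: real
    and T :: "real set" and S :: "real \<Rightarrow> nat \<Rightarrow> real^3"
  assumes "N \<ge> 1"
    and "\<forall>j\<in>{1..N}. \<omega> j \<ge> 0"
    and "lam \<ge> 0"
    and "is_interval T" and "0 \<in> T"
  shows "(\<forall>P. planar_kuramoto_initial N (S 0) (P 0) \<and>
              hamilton_solution N (kuramoto_hamiltonian N \<omega> lam) T S P
              \<longrightarrow> kuramoto_solution N \<omega> lam T S) \<and>
         (planar_spins N (S 0) \<and> kuramoto_solution N \<omega> lam T S \<longrightarrow>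
           (\<exists>P. planar_kuramoto_initial N (S 0) (P 0) \<and>
                hamilton_solution N (kuramoto_hamiltonian N \<omega> lam) T S P))"
proof -
  \<comment> \<open>Where P = S x e3 the two velocity fields agree, as e3 x S = - S x e3.\<close>
  have eq: "spin_velocity N \<omega> lam S P j =
      \<omega> j *\<^sub>R (e3 \<times> S j) + lam *\<^sub>R (S j \<times> (mean_field N S \<times> S j))"
    if "P j = S j \<times> e3" for S P j
    using that cross_skew[of e3 "S j"] by (simp add: spin_velocity_def)
  have "kuramoto_solution N \<omega> lam T S"
    if init: "planar_kuramoto_initial N (S 0) (P 0)"
      and ham: "hamilton_solution N (kuramoto_hamiltonian N \<omega> lam) T S P" for P
  proof -
    have dS: "((\<lambda>s. S s j) has_vector_derivative spin_velocity N \<omega> lam (S t) (P t) j) (at t within T)"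
      and dP: "((\<lambda>s. P s j) has_vector_derivative - spin_gradient N \<omega> lam (S t) (P t) j) (at t within T)"
      if "t \<in> T" "j \<in> {1..N}" for t j
      using ham that unfolding hamilton_solution_iff by blast+
    have dD: "((\<lambda>s. P s j - S s j \<times> e3) has_vector_derivative
        - spin_gradient N \<omega> lam (S t) (P t) j - spin_velocity N \<omega> lam (S t) (P t) j \<times> e3) (at t within T)"
      if "t \<in> T" "j \<in> {1..N}" for t j
      by (intro has_vector_derivative_diff dP that bounded_linear.has_vector_derivative[OF
            bounded_bilinear.bounded_linear_left[OF bounded_bilinear_cross3]] dS)
    have "planar_defect (S t j) (P t j) = 0" if "t \<in> T" "j \<in> {1..N}" for t j
      by (rule planar_defect_invariant[where N = N and T = T and S = S and P = P
            and G = "\<lambda>t j. - spin_gradient N \<omega> lam (S t) (P t) j - spin_velocity N \<omega> lam (S t) (P t) j \<times> e3",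
            OF assms(1,4,5) init]) (use that dS dD in auto)
    then have "P t j = S t j \<times> e3" if "t \<in> T" "j \<in> {1..N}" for t j
      using that by (simp add: planar_defect_def zero_prod_def)
    then show ?thesis
      using dS unfolding kuramoto_solution_def by (simp add: eq)
  qed
  moreover have "\<exists>P. planar_kuramoto_initial N (S 0) (P 0) \<and>
      hamilton_solution N (kuramoto_hamiltonian N \<omega> lam) T S P"
    if planar: "planar_spins N (S 0)" and sol: "kuramoto_solution N \<omega> lam T S"
  proof -
    \<comment> \<open>By the first half, momenta solving Hamilton's equations with planar initial
      data must have this form on \<open>T\<close>.\<close>
    define P where "P = (\<lambda>t j. S t j \<times> e3)"
    have init: "planar_kuramoto_initial N (S 0) (P 0)"
      using planar by (simp add: planar_kuramoto_initial_def P_def)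
    have dS: "((\<lambda>s. S s j) has_vector_derivative spin_velocity N \<omega> lam (S t) (P t) j) (at t within T)"
      if "t \<in> T" "j \<in> {1..N}" for t j
      using sol that unfolding kuramoto_solution_def by (simp add: eq P_def)
    \<comment> \<open>The momentum defect is identically zero here, so invariance only has to
      control heights and radii.\<close>
    have dD: "((\<lambda>s. P s j - S s j \<times> e3) has_vector_derivative 0) (at t within T)" for t j
      by (simp add: P_def)
    have "planar_defect (S t j) (P t j) = 0" if "t \<in> T" "j \<in> {1..N}" for t j
      by (rule planar_defect_invariant[where N = N and T = T and S = S and P = P and G = "\<lambda>t j. 0",
            OF assms(1,4,5) init]) (use that dS dD in auto)
    then have rate: "- spin_gradient N \<omega> lam (S t) (P t) j = spin_velocity N \<omega> lam (S t) (P t) j \<times> e3"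
      if "t \<in> T" "j \<in> {1..N}" for t j
      using that by (intro momentum_defect_rate_zero assms(1)) auto
    \<comment> \<open>Differentiating S x e3 gives the velocity of S crossed with e3, which
      \<open>rate\<close> identifies with the required right-hand side.\<close>
    have "((\<lambda>s. P s j) has_vector_derivative - spin_gradient N \<omega> lam (S t) (P t) j) (at t within T)"
      if "t \<in> T" "j \<in> {1..N}" for t j
      unfolding rate[OF that] unfolding P_def[THEN fun_cong, THEN fun_cong]
      using bounded_linear.has_vector_derivative[OF
          bounded_bilinear.bounded_linear_left[OF bounded_bilinear_cross3] dS[OF that]]
      by (simp add: P_def)
    with init dS show ?thesis
      unfolding hamilton_solution_iff by blast
  qed
  ultimately show ?thesis by blast
qed

end
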